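(* Let $\phi=(1+\sqrt5)/2$. For every irrational $\alpha\in(0,1)$ and every Sturmian word $s_\alpha$ of angle $\alpha$, we have $A(s_\alpha)\geq\sqrt5$. Moreover, $A(s_\alpha)=\sqrt5$ if and only if $\alpha$ is equivalent to $\phi-1$. In particular, the abelian critical exponent of the Fibonacci word (the Sturmian word of angle $\phi-1$ and initial point $\phi-1$) is $\sqrt5$.
   Context: Two real numbers with continued fraction expansions $[a_0;a_1,a_2,\ldots]$ and $[b_0;b_1,b_2,\ldots]$ are equivalent if there exist integers $N,M$ such that $a_{N+i}=b_{M+i}$ for all $i\geq0$. $\{x\}=x-\lfloor x\rfloor$ is the fractional part. For irrational $\alpha\in(0,1)$ and $\rho\in[0,1)$, a Sturmian word of angle $\alpha$ and initial point $\rho$ is the infinite word $c_0c_1c_2\cdots$ over $\{a,b\}$ with $c_n=b$ if $\{\rho+n\alpha\}\in I_b$ and $c_n=a$ if $\{\rho+n\alpha\}\in I_a$, where either $I_b=[0,1-\alpha)$, $I_a=[1-\alpha,1)$, or $I_b=(0,1-\alpha]$, $I_a=(1-\alpha,1]$ with $0$ identified with $1$. $s_\alpha$ denotes any Sturmian word of angle $\alpha$. (For the Fibonacci word the choice of intervals is irrelevant.) The Parikh vector $\mathcal{P}$ of a word over $\{a,b\}$ is the pair (number of $a$'s, number of $b$'s), with norm $|\mathcal P|$ the sum of its components. $\mathcal{P}$ is contained in $\mathcal{Q}$ if $|\mathcal P|<|\mathcal Q|$ and $\mathcal P\leq\mathcal Q$ componentwise. A word $w$ is an abelian power of period $m$ and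 exponent $k$ if $w=u_1\cdots u_k$ where all $u_i$ have length $m$ and the same Parikh vector. A word $w$ is an abelian repetition of period $m$ and exponent $|w|/m$ if $w=u_0u_1\cdots u_{j-1}u_j$ with $j\geq3$, where $u_1,\dots,u_{j-1}$ have length $m$ and the same Parikh vector $\mathcal P$, and the Parikh vectors of $u_0$ and $u_j$ (possibly empty words) are contained in $\mathcal P$. For $m>1$ let $k_m$ (resp. $k'_m$) be the maximum exponent of an abelian power (resp. abelian repetition) of period $m$ that is a factor of $s_\alpha$. The abelian critical exponent of $s_\alpha$ is $A(s_\alpha)=\limsup_{m\to\infty}k_m/m=\limsup_{m\to\infty}k'_m/m\in[0,\infty]$ (the two coincide since $k_m\leq k'_m<k_m+2$). *)

theory Defs
  imports "HOL-Analysis.Analysis"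
begin

section \<open>Continued fractions\<close>

primrec cf_convergent :: "(nat \<Rightarrow> int) \<Rightarrow> nat \<Rightarrow> real" where
  "cf_convergent c 0 = of_int (c 0)"
| "cf_convergent c (Suc n) = of_int (c 0) + 1 / cf_convergent (\<lambda>i. c (Suc i)) n"

text \<open>
  The infinite expansion $x = [c_0; c_1, c_2, \ldots]$. Exactly the irrational numbers have one,
  and it is unique; rational numbers only have finite expansions, which are not covered.
\<close>

definition has_cf_expansion :: "real \<Rightarrow> (nat \<Rightarrow> int) \<Rightarrow> bool" where
  "has_cf_expansion x c \<longleftrightarrow> (\<forall>n\<ge>1. c n \<ge> 1) \<and> cf_convergent c \<longlonglongrightarrow> x"

definition cf_equivalent :: "real \<Rightarrow> real \<Rightarrow> bool" where
  "cf_equivalent x y \<longleftrightarrow>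
     (\<exists>c d. has_cf_expansion x c \<and> has_cf_expansion y d \<and> (\<exists>N M. \<forall>i. c (N + i) = d (M + i)))"

definition golden_ratio :: real where
  "golden_ratio = (1 + sqrt 5) / 2"


section \<open>Sturmian words\<close>

datatype letter = Letter_a | Letter_b

type_synonym word = "letter list"
type_synonym infinite_word = "nat \<Rightarrow> letter"

text \<open>
  The two codings differ in which interval contains the endpoints. In the second one
  $I_b = (0, 1-\alpha]$ and $I_a = (1-\alpha, 1]$ with $0$ identified with $1$, so that
  the fractional part $0$ is coded by $a$.
\<close>

definition sturmian_left_closed :: "real \<Rightarrow> real \<Rightarrow> infinite_word" where
  "sturmian_left_closed \<alpha> \<rho> n =
     (if frac (\<rho> + real n * \<alpha>) \<in> {0..<1 - \<alpha>} then Letter_b else Letter_a)"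

definition sturmian_right_closed :: "real \<Rightarrow> real \<Rightarrow> infinite_word" where
  "sturmian_right_closed \<alpha> \<rho> n =
     (if frac (\<rho> + real n * \<alpha>) \<in> {0<..1 - \<alpha>} then Letter_b else Letter_a)"

definition sturmian_word :: "real \<Rightarrow> real \<Rightarrow> infinite_word \<Rightarrow> bool" where
  "sturmian_word \<alpha> \<rho> s \<longleftrightarrow>
     \<alpha> \<notin> \<rat> \<and> 0 < \<alpha> \<and> \<alpha> < 1 \<and> 0 \<le> \<rho> \<and> \<rho> < 1 \<and>
     (s = sturmian_left_closed \<alpha> \<rho> \<or> s = sturmian_right_closed \<alpha> \<rho>)"

definition fibonacci_word :: infinite_word where
  "fibonacci_word = sturmian_left_closed (golden_ratio - 1) (golden_ratio - 1)"

text \<open>For the Fibonacci word the choice of intervals is irrelevant.\<close>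

lemma sqrt_5_irrational: "sqrt 5 \<notin> \<rat>"
proof
  assume "sqrt 5 \<in> \<rat>"
  then obtain p q :: nat where pq: "q \<noteq> 0" "\<bar>sqrt 5\<bar> = real p / real q" "coprime p q"
    by (rule Rats_abs_nat_div_natE)
  then have "real p = sqrt 5 * real q"
    by (simp add: field_simps)
  then have "(real p)\<^sup>2 = 5 * (real q)\<^sup>2"
    by (simp add: power_mult_distrib)
  then have "real (p\<^sup>2) = real (5 * q\<^sup>2)"
    by simp
  then have eq: "p\<^sup>2 = 5 * q\<^sup>2"
    by (simp only: of_nat_eq_iff)
  have 5: "prime (5 :: nat)"
    by (simp add: prime_nat_numeral_eq)
  from eq have "5 dvd p\<^sup>2"
    by simp
  with 5 have p: "5 dvd p"
    by (rule prime_dvd_power)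
  then obtain r where "p = 5 * r" ..
  with eq have "q\<^sup>2 = 5 * r\<^sup>2"
    by (simp add: power2_eq_square)
  then have "5 dvd q\<^sup>2"
    by simp
  with 5 have "5 dvd q"
    by (rule prime_dvd_power)
  with p pq(3) have "is_unit (5 :: nat)"
    using coprime_common_divisor by blast
  then show False
    by simp
qed

lemma golden_ratio_irrational: "golden_ratio \<notin> \<rat>"
proof
  assume "golden_ratio \<in> \<rat>"
  then have "2 * golden_ratio - 1 \<in> \<rat>"
    by (intro Rats_diff Rats_mult) auto
  moreover have "2 * golden_ratio - 1 = sqrt 5"
    by (simp add: golden_ratio_def field_simps)
  ultimately show False
    using sqrt_5_irrational by simp
qed

lemma sturmian_word_fibonacci_iff:
  "sturmian_word (golden_ratio - 1) (golden_ratio - 1) s \<longleftrightarrow> s = fibonacci_word"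
proof -
  define \<alpha> where "\<alpha> = golden_ratio - 1"
  have irr: "\<alpha> \<notin> \<rat>"
  proof
    assume "\<alpha> \<in> \<rat>"
    then have "\<alpha> + 1 \<in> \<rat>"
      by (intro Rats_add) auto
    then show False
      using golden_ratio_irrational by (simp add: \<alpha>_def)
  qed
  have mult: "real (Suc n) * \<alpha> \<notin> \<int>" for n
  proof
    assume "real (Suc n) * \<alpha> \<in> \<int>"
    then have "real (Suc n) * \<alpha> / real (Suc n) \<in> \<rat>"
      using Ints_subset_Rats by (intro Rats_divide) auto
    then show False
      using irr by simp
  qed
  have bounds: "0 < \<alpha>" "\<alpha> < 1"
    using real_sqrt_less_iff[of 1 5] real_sqrt_less_iff[of 5 9]
    by (auto simp: \<alpha>_def golden_ratio_def)
  have "frac (\<alpha> + real n * \<alpha>) \<noteq> 0" for n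
    using mult[of n] by (simp add: algebra_simps)
  moreover have "frac (\<alpha> + real n * \<alpha>) \<noteq> 1 - \<alpha>" for n
  proof
    assume "frac (\<alpha> + real n * \<alpha>) = 1 - \<alpha>"
    then have "real (Suc (Suc n)) * \<alpha> = of_int (\<lfloor>\<alpha> + real n * \<alpha>\<rfloor> + 1)"
      by (simp add: frac_def algebra_simps)
    then show False
      using mult[of "Suc n"] Ints_of_int by metis
  qed
  ultimately have "sturmian_left_closed \<alpha> \<alpha> = sturmian_right_closed \<alpha> \<alpha>"
    by (intro ext) (auto simp: sturmian_left_closed_def sturmian_right_closed_def
        order.order_iff_strict)
  then show ?thesis
    using irr bounds by (auto simp: sturmian_word_def fibonacci_word_def \<alpha>_def)
qed

definition is_factor :: "word \<Rightarrow> infinite_word \<Rightarrow> bool" where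
  "is_factor w s \<longleftrightarrow> (\<exists>i. w = map s [i..<i + length w])"


section \<open>Abelian powers and repetitions\<close>

definition parikh :: "word \<Rightarrow> nat \<times> nat" where
  "parikh w = (count_list w Letter_a, count_list w Letter_b)"

definition parikh_norm :: "nat \<times> nat \<Rightarrow> nat" where
  "parikh_norm P = fst P + snd P"

definition parikh_contained :: "nat \<times> nat \<Rightarrow> nat \<times> nat \<Rightarrow> bool" where
  "parikh_contained P Q \<longleftrightarrow>
     parikh_norm P < parikh_norm Q \<and> fst P \<le> fst Q \<and> snd P \<le> snd Q"

definition abelian_power :: "nat \<Rightarrow> nat \<Rightarrow> word \<Rightarrow> bool" where
  "abelian_power m k w \<longleftrightarrow>
     (\<exists>us P. w = concat us \<and> length us = k \<and> (\<forall>u\<in>set us. length u = m \<and> parikh u = P))"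

text \<open>
  Below, \<open>us\<close> lists the $j - 1$ inner blocks $u_1, \ldots, u_{j-1}$ of
  $u_0 u_1 \cdots u_{j-1} u_j$, so $j \ge 3$ becomes \<open>length us \<ge> 2\<close>.
\<close>

definition abelian_repetition :: "nat \<Rightarrow> word \<Rightarrow> bool" where
  "abelian_repetition m w \<longleftrightarrow>
     (\<exists>u0 us uj P. w = u0 @ concat us @ uj \<and> length us \<ge> 2 \<and>
        (\<forall>u\<in>set us. length u = m \<and> parikh u = P) \<and>
        parikh_contained (parikh u0) P \<and> parikh_contained (parikh uj) P)"


section \<open>The abelian critical exponent\<close>

text \<open>
  The maximal exponents are formed as suprema in $[0, \infty]$. They agree with the maxima
  whenever these exist, as they do for Sturmian words and positive \<open>m\<close>.
\<close>

definition max_power_exponent :: "infinite_word \<Rightarrow> nat \<Rightarrow> ennreal" where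
  "max_power_exponent s m = (SUP k\<in>{k. \<exists>w. is_factor w s \<and> abelian_power m k w}. of_nat k)"

definition max_repetition_exponent :: "infinite_word \<Rightarrow> nat \<Rightarrow> ennreal" where
  "max_repetition_exponent s m =
     (SUP w\<in>{w. is_factor w s \<and> abelian_repetition m w}. ennreal (real (length w) / real m))"

definition abelian_critical_exponent :: "infinite_word \<Rightarrow> ennreal" where
  "abelian_critical_exponent s = limsup (\<lambda>m. max_power_exponent s m / of_nat m)"

text \<open>Abelian repetitions give the same value.\<close>

lemma is_factor_infix:
  assumes "is_factor (x @ y @ z) s"
  shows "is_factor y s"
proof -
  from assms obtain i where i: "x @ y @ z = map s [i..<i + length (x @ y @ z)]"
    unfolding is_factor_def by blast
  have "y = take (length y) (drop (length x) (x @ y @ z))"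
    by simp
  also have "\<dots> = map s [i + length x..<i + length x + length y]"
    by (subst i) (simp add: take_map drop_map)
  finally show ?thesis
    unfolding is_factor_def by blast
qed

lemma length_eq_parikh_norm: "length w = parikh_norm (parikh w)"
proof (induction w)
  case (Cons x w)
  then show ?case
    by (cases x) (auto simp: parikh_def parikh_norm_def)
qed (simp add: parikh_def parikh_norm_def)

lemma length_concat_blocks:
  assumes "\<forall>u\<in>set us. length u = m"
  shows "length (concat us) = length us * m"
  using assms by (induction us) auto

lemma max_power_exponent_le:
  assumes "m > 0"
  shows "max_power_exponent s m \<le> max_repetition_exponent s m + 1"
  unfolding max_power_exponent_def
proof (rule SUP_least, clarify)
  fix k w us P
  assume f: "is_factor w s" and p: "abelian_power m k w"
  show "of_nat k \<le> max_repetition_exponent s m + 1"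
  proof (cases "k \<ge> 2")
    case True
    from p obtain us P where us: "w = concat us" "length us = k"
      "\<forall>u\<in>set us. length u = m \<and> parikh u = P"
      unfolding abelian_power_def by blast
    from True us(2) obtain u where "u \<in> set us"
      by (cases us) auto
    with us(3) assms have "parikh_norm P > 0"
      using length_eq_parikh_norm by metis
    then have "parikh_contained (parikh []) P"
      by (simp add: parikh_contained_def parikh_def parikh_norm_def)
    then have "abelian_repetition m w"
      unfolding abelian_repetition_def using us True
      by (intro exI[of _ "[]"] exI[of _ us] exI[of _ P]) auto
    with f have "ennreal (real (length w) / real m) \<le> max_repetition_exponent s m"
      unfolding max_repetition_exponent_def by (intro SUP_upper) auto
    moreover have "length w = k * m"
      using us length_concat_blocks[of us m] by simp
    ultimately have "of_nat k \<le> max_repetition_exponent s m"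
      using assms by (simp add: ennreal_of_nat_eq_real_of_nat)
    then show ?thesis
      by (simp add: add_increasing2)
  next
    case False
    then have "(of_nat k :: ennreal) \<le> of_nat 1"
      by (intro of_nat_mono) simp
    then show ?thesis
      by (simp add: add_increasing)
  qed
qed

lemma max_repetition_exponent_le:
  assumes "m > 0"
  shows "max_repetition_exponent s m \<le> max_power_exponent s m + 2"
  unfolding max_repetition_exponent_def
proof (rule SUP_least, clarify)
  fix w
  assume f: "is_factor w s" and r: "abelian_repetition m w"
  from r obtain u0 us uj P where
    us: "w = u0 @ concat us @ uj" "length us \<ge> 2" "\<forall>u\<in>set us. length u = m \<and> parikh u = P"
      "parikh_contained (parikh u0) P" "parikh_contained (parikh uj) P"
    unfolding abelian_repetition_def by blast
  from us(2) obtain u where "u \<in> set us"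
    by (cases us) auto
  with us(3) have "parikh_norm P = m"
    using length_eq_parikh_norm by metis
  with us(4,5) have "length u0 < m" "length uj < m"
    by (auto simp: parikh_contained_def length_eq_parikh_norm)
  moreover have "length (concat us) = length us * m"
    using us(3) length_concat_blocks by blast
  ultimately have "length w \<le> (length us + 2) * m"
    using us(1) by simp
  then have "real (length w) \<le> real (length us + 2) * real m"
    by (simp only: of_nat_mult[symmetric] of_nat_le_iff)
  then have "ennreal (real (length w) / real m) \<le> ennreal (real (length us + 2))"
    using assms by (intro ennreal_leI) (simp add: divide_simps)
  also have "\<dots> = of_nat (length us) + 2"
    by (simp only: ennreal_of_nat_eq_real_of_nat[symmetric]) simp
  also have "of_nat (length us) \<le> max_power_exponent s m"
    unfolding max_power_exponent_def
  proof (rule SUP_upper, clarify)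
    have "is_factor (concat us) s"
      using f us(1) is_factor_infix by blast
    moreover have "abelian_power m (length us) (concat us)"
      using us(3) unfolding abelian_power_def by blast
    ultimately show "\<exists>w. is_factor w s \<and> abelian_power m (length us) w"
      by blast
  qed
  finally show "ennreal (real (length w) / real m) \<le> max_power_exponent s m + 2"
    by (simp add: add_right_mono)
qed

lemma limsup_divide_of_nat_le:
  fixes f g :: "nat \<Rightarrow> ennreal"
  assumes "\<And>m. m > 0 \<Longrightarrow> f m \<le> g m + of_nat c"
  shows "limsup (\<lambda>m. f m / of_nat m) \<le> limsup (\<lambda>m. g m / of_nat m)"
proof (rule ennreal_le_epsilon)
  fix e :: real
  assume "e > 0"
  then have "\<forall>\<^sub>F m in sequentially. real c / real m < e"
    by (intro order_tendstoD(2)[OF lim_const_over_n])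
  then have "\<forall>\<^sub>F m in sequentially. f m / of_nat m \<le> ennreal e + g m / of_nat m"
    using eventually_gt_at_top[of 0]
  proof eventually_elim
    case (elim m)
    have "f m / of_nat m \<le> (g m + of_nat c) / of_nat m"
      using assms[OF elim(2)] by (rule divide_right_mono_ennreal)
    also have "\<dots> = of_nat c / of_nat m + g m / of_nat m"
      by (simp add: add_divide_distrib_ennreal add.commute)
    also have "(of_nat c / of_nat m :: ennreal) = ennreal (real c / real m)"
      using elim by (simp add: ennreal_of_nat_eq_real_of_nat divide_ennreal)
    also have "ennreal (real c / real m) \<le> ennreal e"
      using elim(1) by (intro ennreal_leI) simp
    finally show ?case
      by (simp add: add_right_mono)
  qed
  then have "limsup (\<lambda>m. f m / of_nat m) \<le> limsup (\<lambda>m. ennreal e + g m / of_nat m)"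
    by (rule Limsup_mono)
  also have "\<dots> = ennreal e + limsup (\<lambda>m. g m / of_nat m)"
    by (rule Limsup_const_add) auto
  finally show "limsup (\<lambda>m. f m / of_nat m) \<le> limsup (\<lambda>m. g m / of_nat m) + ennreal e"
    by (simp add: add.commute)
qed

lemma abelian_critical_exponent_eq_repetition:
  "abelian_critical_exponent s = limsup (\<lambda>m. max_repetition_exponent s m / of_nat m)"
  unfolding abelian_critical_exponent_def
  using max_power_exponent_le[of _ s] max_repetition_exponent_le[of _ s]
  by (intro antisym limsup_divide_of_nat_le[where c = 1] limsup_divide_of_nat_le[where c = 2]) auto

end

theory Submission
  imports Defs
begin

text \<open>
  The number of letters $a$ in a Sturmian factor is a difference of two rounded points of the
  orbit of the rotation by $\alpha$, so an abelian power of period $m$ and exponent $k$ occurs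
  if and only if $k |m\alpha - p| < 1$ for some integer $p$: one direction is immediate, the
  other is the density of the orbit. Hence the abelian critical exponent is the Lagrange constant
  $\limsup 1 / (m \Vert m\alpha \Vert)$, and the theorem is a form of Hurwitz's theorem.

  For the lower bounds, the denominators $q_n$ of the convergents satisfy
  $1 / (q_n |q_n\alpha - p_n|) = x_{n+1} + q_{n-1}/q_n$ with $x_{n+1}$ the complete quotient.
  If infinitely many partial quotients differ from 1, this is at least $8/3 > \sqrt 5$ infinitely
  often; otherwise it is at least $\phi + 1/\phi = \sqrt 5$ infinitely often. For the upper bound,
  an $\alpha$ equivalent to $\phi - 1$ is a root of an integral quadratic $f$ of discriminant 5.
  The integer $m^2 f(p/m)$ is nonzero, and $f'(\alpha) = \pm\sqrt 5$, which gives
  $1 \le m |m\alpha - p| (\sqrt 5 + o(1))$.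
\<close>

section \<open>Continued fraction expansions\<close>

lemma cf_convergent_ge_1:
  assumes "\<And>n. c n \<ge> 1"
  shows "cf_convergent c n \<ge> 1"
  using assms
proof (induction n arbitrary: c)
  case (Suc n)
  have "cf_convergent (\<lambda>i. c (Suc i)) n \<ge> 1"
    by (rule Suc.IH) (rule Suc.prems)
  then have "1 / cf_convergent (\<lambda>i. c (Suc i)) n > 0"
    by simp
  moreover have "real_of_int (c 0) \<ge> 1"
    using Suc.prems[of 0] by simp
  ultimately show ?case
    unfolding cf_convergent.simps by linarith
qed simp

text \<open>Two steps at least halve the error: peeling off \<open>c 0\<close> and
  \<open>c 1\<close> divides it by \<open>(u * v) * (x 1 * x 2)\<close>, where
  \<open>x 1 * x 2 = c 1 * x 2 + 1\<close> is at least 2. The induction varies \<open>c\<close> and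
  \<open>x\<close> because \<open>cf_convergent\<close> recurses on the shifted sequence.\<close>

lemma cf_convergent_error:
  fixes x :: "nat \<Rightarrow> real"
  assumes "\<And>n. x n = of_int (c n) + 1 / x (Suc n)" "\<And>n. x (Suc n) \<ge> 1" "\<And>n. c (Suc n) \<ge> 1"
  shows "\<bar>cf_convergent c n - x 0\<bar> \<le> (1 / 2) ^ (n div 2)"
  using assms
proof (induction n arbitrary: c x rule: induct_nat_012)
  case 0
  show ?case
    using 0(1)[of 0] 0(2)[of 0] by simp
next
  case 1
  have "0 \<le> 1 / x 1" "1 / x 1 \<le> 1" "0 \<le> 1 / real_of_int (c 1)" "1 / real_of_int (c 1) \<le> 1"
    using 1(2)[of 0] 1(3)[of 0] by simp_all
  then have "\<bar>1 / real_of_int (c 1) - 1 / x 1\<bar> \<le> 1"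
    by linarith
  then show ?case
    using 1(1)[of 0] by simp
next
  case (ge2 n)
  define u where "u = cf_convergent (\<lambda>i. c (Suc (Suc i))) n"
  define v where "v = cf_convergent (\<lambda>i. c (Suc i)) (Suc n)"
  have u: "u \<ge> 1" and v: "v \<ge> 1"
    unfolding u_def v_def by (rule cf_convergent_ge_1, rule ge2.prems(3))+
  have vu: "v = of_int (c 1) + 1 / u"
    by (simp add: u_def v_def)
  have x1: "x 1 = of_int (c 1) + 1 / x 2" "x 1 \<ge> 1" "x 2 \<ge> 1"
    using ge2.prems(1)[of 1] ge2.prems(2)[of 0] ge2.prems(2)[of 1] by (auto simp: numeral_2_eq_2)
  have c1: "real_of_int (c 1) \<ge> 1"
    using ge2.prems(3)[of 0] by simp
  have "x 1 * x 2 = of_int (c 1) * x 2 + 1"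
    using x1 by (simp add: field_simps)
  moreover have "of_int (c 1) * x 2 \<ge> 1"
    using mult_mono[OF c1 x1(3)] c1 by simp
  ultimately have x12: "x 1 * x 2 \<ge> 2"
    by linarith
  have uv: "u * v \<ge> 1"
    using mult_mono[OF u v] u by simp
  have IH: "\<bar>u - x 2\<bar> \<le> (1 / 2) ^ (n div 2)"
    using ge2.IH(1)[of "\<lambda>i. x (Suc (Suc i))" "\<lambda>i. c (Suc (Suc i))",
        OF ge2.prems(1) ge2.prems(2) ge2.prems(3)]
    by (simp only: u_def numeral_2_eq_2)
  have "cf_convergent c (Suc (Suc n)) - x 0 = 1 / v - 1 / x 1"
    using ge2.prems(1)[of 0] by (simp add: v_def)
  also have "\<dots> = (x 1 - v) / (v * x 1)"
    using v x1(2) by (simp add: field_simps)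
  also have "x 1 - v = (u - x 2) / (u * x 2)"
    using u x1 by (simp add: vu field_simps)
  finally have "\<bar>cf_convergent c (Suc (Suc n)) - x 0\<bar> = \<bar>u - x 2\<bar> / ((u * v) * (x 1 * x 2))"
    using u v x1(2,3) by (simp add: abs_mult abs_div mult_ac)
  also have "\<dots> \<le> \<bar>u - x 2\<bar> / (1 * 2)"
    by (intro divide_left_mono mult_mono uv x12) (use uv x12 in auto)
  also have "\<dots> \<le> (1 / 2) ^ (Suc (Suc n) div 2)"
    using IH by simp
  finally show ?case .
qed

text \<open>Complete quotients serve as a certificate for an expansion. No lower bound is put on
  \<open>x 0\<close>, since the leading coefficient may be any integer.\<close>

lemma has_cf_expansionI:
  fixes x :: "nat \<Rightarrow> real"
  assumes "\<And>n. x n = of_int (c n) + 1 / x (Suc n)" "\<And>n. x (Suc n) \<ge> 1" "\<And>n. c (Suc n) \<ge> 1"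
  shows "has_cf_expansion (x 0) c"
  unfolding has_cf_expansion_def
proof
  show "\<forall>n\<ge>1. c n \<ge> 1"
    using assms(3) by (metis One_nat_def Suc_le_D)
  have "filterlim (\<lambda>n::nat. n div 2) at_top sequentially"
    by (rule filterlim_at_top_div_const_nat) simp
  then have "(\<lambda>n. (1 / 2 :: real) ^ (n div 2)) \<longlonglongrightarrow> 0"
    by (rule filterlim_compose[rotated]) (simp add: LIMSEQ_power_zero)
  then have "(\<lambda>n. cf_convergent c n - x 0) \<longlonglongrightarrow> 0"
    by (rule Lim_null_comparison[rotated])
       (use cf_convergent_error[of x c, OF assms] in auto)
  then show "cf_convergent c \<longlonglongrightarrow> x 0"
    by (rule LIM_zero_cancel)
qed

lemma has_cf_expansion_unique:
  "has_cf_expansion x c \<Longrightarrow> has_cf_expansion y c \<Longrightarrow> x = y"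
  unfolding has_cf_expansion_def using LIMSEQ_unique by blast

text \<open>The convergents of the tail lie between 1 and \<open>c 1 + 1\<close>, so the limit of
  their reciprocals is positive and can be inverted.\<close>

lemma has_cf_expansion_tail:
  assumes "has_cf_expansion x c"
  obtains y where "has_cf_expansion y (\<lambda>i. c (Suc i))" "y \<noteq> 0" "x = of_int (c 0) + 1 / y"
proof -
  define v where "v = (\<lambda>n. cf_convergent (\<lambda>i. c (Suc i)) n)"
  have c: "c (Suc n) \<ge> 1" for n
    using assms by (simp add: has_cf_expansion_def)
  have lim: "cf_convergent c \<longlonglongrightarrow> x"
    using assms by (simp add: has_cf_expansion_def)
  have v1: "v n \<ge> 1" for n
    unfolding v_def using c by (intro cf_convergent_ge_1) auto
  have v_le: "v n \<le> of_int (c 1) + 1" for n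
  proof (cases n)
    case (Suc k)
    have "cf_convergent (\<lambda>i. c (Suc (Suc i))) k \<ge> 1"
      using c by (intro cf_convergent_ge_1) auto
    then show ?thesis
      by (simp add: v_def Suc)
  qed (simp add: v_def)
  have "(\<lambda>n. cf_convergent c (Suc n) - of_int (c 0)) \<longlonglongrightarrow> x - of_int (c 0)"
    using lim by (intro tendsto_diff tendsto_const) (rule LIMSEQ_Suc)
  then have inv: "(\<lambda>n. 1 / v n) \<longlonglongrightarrow> x - of_int (c 0)"
    by (simp add: v_def)
  have "1 / (of_int (c 1) + 1) \<le> 1 / v n" for n
    using v1[of n] v_le[of n] by (intro divide_left_mono) auto
  then have "1 / (of_int (c 1) + 1) \<le> x - of_int (c 0)"
    by (intro LIMSEQ_le_const[OF inv]) auto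
  moreover have "1 / (of_int (c 1) + 1) > (0 :: real)"
    using c[of 0] by simp
  ultimately have pos: "x - of_int (c 0) > 0"
    by linarith
  then have "(\<lambda>n. 1 / (1 / v n)) \<longlonglongrightarrow> 1 / (x - of_int (c 0))"
    by (intro tendsto_divide tendsto_const inv) auto
  then have "has_cf_expansion (1 / (x - of_int (c 0))) (\<lambda>i. c (Suc i))"
    using c by (simp add: has_cf_expansion_def v_def)
  then show ?thesis
    by (rule that) (use pos in auto)
qed

section \<open>Quadratic irrationals of discriminant 5\<close>

text \<open>The discriminant is fixed, and not only the field, because it is the square of the
  derivative at a root and so determines the approximation constant.\<close>

definition quadratic_disc5 :: "real \<Rightarrow> bool" where
  "quadratic_disc5 x \<longleftrightarrow> (\<exists>A B C :: int.
     of_int A * x\<^sup>2 + of_int B * x + of_int C = 0 \<and> B\<^sup>2 - 4 * A * C = 5)"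

text \<open>The substitution \<open>x = c + 1 / y\<close> has an integral matrix of determinant -1,
  hence preserves integrality and discriminant in both directions.\<close>

lemma quadratic_disc5_step:
  assumes "y \<noteq> 0"
  shows "quadratic_disc5 (of_int c + 1 / y) \<longleftrightarrow> quadratic_disc5 y"
proof
  assume "quadratic_disc5 (of_int c + 1 / y)"
  then obtain A B C :: int where *:
    "of_int A * (of_int c + 1 / y)\<^sup>2 + of_int B * (of_int c + 1 / y) + of_int C = 0"
    "B\<^sup>2 - 4 * A * C = 5"
    unfolding quadratic_disc5_def by blast
  have "of_int (A * c\<^sup>2 + B * c + C) * y\<^sup>2 + of_int (2 * A * c + B) * y + of_int A
      = (of_int A * (of_int c + 1 / y)\<^sup>2 + of_int B * (of_int c + 1 / y) + of_int C) * y\<^sup>2"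
    using assms by (simp add: field_simps power2_eq_square)
  also have "\<dots> = 0"
    using *(1) by simp
  finally have "of_int (A * c\<^sup>2 + B * c + C) * y\<^sup>2 + of_int (2 * A * c + B) * y + of_int A = 0" .
  moreover have "(2 * A * c + B)\<^sup>2 - 4 * (A * c\<^sup>2 + B * c + C) * A = 5"
    using *(2) by (simp add: algebra_simps power2_eq_square)
  ultimately show "quadratic_disc5 y"
    unfolding quadratic_disc5_def by blast
next
  assume "quadratic_disc5 y"
  then obtain A B C :: int where *:
    "of_int A * y\<^sup>2 + of_int B * y + of_int C = 0" "B\<^sup>2 - 4 * A * C = 5"
    unfolding quadratic_disc5_def by blast
  define x where "x = of_int c + 1 / y"
  \<comment> \<open>These are the coefficients of
    \<open>C * (x - c)^2 + B * (x - c) + A\<close>.\<close>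
  have "of_int C * x\<^sup>2 + of_int (B - 2 * C * c) * x + of_int (A - B * c + C * c\<^sup>2)
      = (of_int A * y\<^sup>2 + of_int B * y + of_int C) / y\<^sup>2"
    using assms by (simp add: x_def field_simps power2_eq_square)
  also have "\<dots> = 0"
    using *(1) by simp
  finally have "of_int C * x\<^sup>2 + of_int (B - 2 * C * c) * x + of_int (A - B * c + C * c\<^sup>2) = 0" .
  moreover have "(B - 2 * C * c)\<^sup>2 - 4 * C * (A - B * c + C * c\<^sup>2) = 5"
    using *(2) by (simp add: algebra_simps power2_eq_square)
  ultimately have "quadratic_disc5 x"
    unfolding quadratic_disc5_def by blast
  then show "quadratic_disc5 (of_int c + 1 / y)"
    by (simp add: x_def)
qed

lemma quadratic_disc5_tail:
  assumes "has_cf_expansion x c"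
  obtains y where "has_cf_expansion y (\<lambda>i. c (N + i))" "quadratic_disc5 x \<longleftrightarrow> quadratic_disc5 y"
  using assms
proof (induction N arbitrary: x c thesis)
  case 0
  then show ?case
    by simp
next
  case (Suc N)
  obtain z where z: "has_cf_expansion z (\<lambda>i. c (Suc i))" "z \<noteq> 0" "x = of_int (c 0) + 1 / z"
    using has_cf_expansion_tail[OF Suc.prems(2)] .
  obtain y where y: "has_cf_expansion y (\<lambda>i. c (Suc (N + i)))"
    "quadratic_disc5 z \<longleftrightarrow> quadratic_disc5 y"
    using Suc.IH[OF _ z(1)] .
  show ?case
    by (rule Suc.prems(1)[of y]) (use y z quadratic_disc5_step in auto)
qed

section \<open>The golden ratio and the numbers equivalent to it\<close>

lemma golden_ratio_gt_1: "golden_ratio > 1"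
  using real_sqrt_gt_1_iff[of 5] by (simp add: golden_ratio_def)

lemma golden_ratio_fixed_point: "1 + 1 / golden_ratio = golden_ratio"
proof -
  have "golden_ratio * golden_ratio = golden_ratio + 1"
    by (simp add: golden_ratio_def field_simps)
  then show ?thesis
    using golden_ratio_gt_1 by (simp add: field_simps)
qed

lemma quadratic_disc5_golden_ratio: "quadratic_disc5 (golden_ratio - 1)"
  unfolding quadratic_disc5_def
  by (rule exI[of _ 1], rule exI[of _ 1], rule exI[of _ "-1"])
     (simp add: golden_ratio_def field_simps power2_eq_square)

text \<open>The common tail has a single value, so the property passes down one expansion and back
  up the other.\<close>

lemma cf_equivalent_golden_ratio_imp_quadratic_disc5:
  assumes "cf_equivalent \<alpha> (golden_ratio - 1)"
  shows "quadratic_disc5 \<alpha>"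
proof -
  from assms obtain c d N M where c: "has_cf_expansion \<alpha> c"
    and d: "has_cf_expansion (golden_ratio - 1) d" and tail: "\<And>i. c (N + i) = d (M + i)"
    unfolding cf_equivalent_def by blast
  obtain y where y: "has_cf_expansion y (\<lambda>i. c (N + i))" "quadratic_disc5 \<alpha> \<longleftrightarrow> quadratic_disc5 y"
    using quadratic_disc5_tail[OF c] .
  obtain z where z: "has_cf_expansion z (\<lambda>i. d (M + i))"
    "quadratic_disc5 (golden_ratio - 1) \<longleftrightarrow> quadratic_disc5 z"
    using quadratic_disc5_tail[OF d] .
  have "y = z"
    using y(1) z(1) tail has_cf_expansion_unique by simp
  then show ?thesis
    using y z quadratic_disc5_golden_ratio by blast
qed

section \<open>Diophantine bound for discriminant 5\<close>

text \<open>The constant \<open>K\<close> is the absolute value of the leading coefficient. It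
  bounds the second-order term of the quadratic around \<alpha> and is independent of
  \<open>m\<close>, so it disappears in the limsup.\<close>

lemma quadratic_disc5_approximation:
  assumes "quadratic_disc5 \<alpha>"
  obtains K :: nat where "\<And>(m :: nat) (k :: nat) (p :: int).
    m > 0 \<Longrightarrow> real k * \<bar>real m * \<alpha> - of_int p\<bar> < 1 \<Longrightarrow> real k \<le> real m * sqrt 5 + real K"
proof -
  from assms obtain A B C :: int where *:
    "of_int A * \<alpha>\<^sup>2 + of_int B * \<alpha> + of_int C = 0" "B\<^sup>2 - 4 * A * C = 5"
    unfolding quadratic_disc5_def by blast
  \<comment> \<open>For \<open>f = A x^2 + B x + C\<close> this is the identity
    \<open>f'^2 = 4 A f + disc\<close>.\<close>
  have "(2 * of_int A * \<alpha> + of_int B)\<^sup>2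
      = 4 * of_int A * (of_int A * \<alpha>\<^sup>2 + of_int B * \<alpha> + of_int C) + of_int (B\<^sup>2 - 4 * A * C)"
    by (simp add: algebra_simps power2_eq_square)
  then have "(2 * of_int A * \<alpha> + of_int B)\<^sup>2 = 5"
    using * by simp
  then have deriv: "\<bar>2 * of_int A * \<alpha> + of_int B\<bar> = sqrt 5"
    by (metis real_sqrt_abs)
  have "real k \<le> real m * sqrt 5 + real (nat \<bar>A\<bar>)"
    if m: "m > 0" and k: "real k * \<bar>real m * \<alpha> - of_int p\<bar> < 1" for m k :: nat and p :: int
  proof (cases "k = 0")
    case False
    define e where "e = of_int p - real m * \<alpha>"
    \<comment> \<open>This is \<open>m^2 * f(p/m)\<close>.\<close>
    define N where "N = A * p\<^sup>2 + B * p * int m + C * (int m)\<^sup>2"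
    have ke: "real k * \<bar>e\<bar> < 1"
      using k by (simp add: e_def abs_minus_commute)
    have e1: "\<bar>e\<bar> \<le> 1"
      using mult_right_mono[of 1 "real k" "\<bar>e\<bar>"] False ke by simp
    have "N \<noteq> 0"
    proof
      assume "N = 0"
      \<comment> \<open>Completing the square: a zero of the form would make \<open>sqrt 5\<close>
        rational.\<close>
      have "(2 * A * p + B * int m)\<^sup>2 = 4 * A * N + (B\<^sup>2 - 4 * A * C) * (int m)\<^sup>2"
        by (simp add: N_def algebra_simps power2_eq_square)
      then have "(2 * A * p + B * int m)\<^sup>2 = 5 * (int m)\<^sup>2"
        using \<open>N = 0\<close> *(2) by simp
      then have "(real_of_int (2 * A * p + B * int m))\<^sup>2 = 5 * (real m)\<^sup>2"
        by (metis of_int_mult of_int_numeral of_int_of_nat_eq of_int_power)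
      then have "sqrt ((real_of_int (2 * A * p + B * int m))\<^sup>2) = sqrt (5 * (real m)\<^sup>2)"
        by simp
      then have "\<bar>real_of_int (2 * A * p + B * int m)\<bar> = sqrt 5 * real m"
        by (simp add: real_sqrt_mult)
      then have "sqrt 5 = of_int \<bar>2 * A * p + B * int m\<bar> / of_nat m"
        using m by (simp add: field_simps)
      moreover have "real_of_int \<bar>2 * A * p + B * int m\<bar> / of_nat m \<in> \<rat>"
        by (intro Rats_divide Rats_of_int Rats_of_nat)
      ultimately show False
        using sqrt_5_irrational by metis
    qed
    then have "1 \<le> \<bar>real_of_int N\<bar>"
      by linarith
    moreover have p: "of_int p = real m * \<alpha> + e"
      by (simp add: e_def)
    define D where "D = 2 * of_int A * \<alpha> + of_int B"
    have deriv_D: "\<bar>D\<bar> = sqrt 5"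
      using deriv by (simp only: D_def)
    \<comment> \<open>The Taylor expansion at \<alpha>, exact for a quadratic; the last summand
      vanishes.\<close>
    have "real_of_int N = D * e * real m + of_int A * e\<^sup>2
        + (of_int A * \<alpha>\<^sup>2 + of_int B * \<alpha> + of_int C) * (real m)\<^sup>2"
      by (simp add: N_def D_def p algebra_simps power2_eq_square)
    then have "\<bar>real_of_int N\<bar> \<le> \<bar>D * e * real m\<bar> + \<bar>of_int A * e\<^sup>2\<bar>"
      using * by simp
    then have "\<bar>real_of_int N\<bar> \<le> sqrt 5 * real m * \<bar>e\<bar> + \<bar>of_int A\<bar> * \<bar>e\<bar> * \<bar>e\<bar>"
      using deriv_D by (simp add: abs_mult power2_eq_square mult_ac)
    ultimately have "1 \<le> (sqrt 5 * real m + \<bar>of_int A\<bar> * \<bar>e\<bar>) * \<bar>e\<bar>"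
      by (simp add: algebra_simps)
    also have "\<dots> \<le> (sqrt 5 * real m + \<bar>of_int A\<bar>) * \<bar>e\<bar>"
      using e1 by (intro mult_right_mono add_left_mono) (auto intro: mult_left_le)
    finally have "real k * 1 \<le> real k * ((sqrt 5 * real m + \<bar>of_int A\<bar>) * \<bar>e\<bar>)"
      by (intro mult_left_mono) auto
    also have "\<dots> = (sqrt 5 * real m + \<bar>of_int A\<bar>) * (real k * \<bar>e\<bar>)"
      by (simp add: mult_ac)
    also have "\<dots> \<le> (sqrt 5 * real m + \<bar>of_int A\<bar>) * 1"
      using ke by (intro mult_left_mono) auto
    finally show ?thesis
      by (simp add: mult_ac)
  qed simp
  then show ?thesis
    by (rule that)
qed

section \<open>Abelian powers in Sturmian words\<close>

text \<open>A letter a is read exactly when adding \<alpha> increases the rounded value, with floor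
  for the left-closed coding and ceiling for the right-closed one; the count then telescopes. The
  function \<open>r\<close> lets later arguments treat both codings at once.\<close>

lemma count_letter_a_sturmian:
  assumes "sturmian_word \<alpha> \<rho> s"
  obtains r :: "real \<Rightarrow> int" where "r = floor \<or> r = ceiling"
    "\<And>i n. int (count_list (map s [i..<i + n]) Letter_a)
       = r (\<rho> + real (i + n) * \<alpha>) - r (\<rho> + real i * \<alpha>)"
proof -
  have \<alpha>: "0 < \<alpha>" "\<alpha> < 1" and s: "s = sturmian_left_closed \<alpha> \<rho> \<or> s = sturmian_right_closed \<alpha> \<rho>"
    using assms by (auto simp: sturmian_word_def)
  have "\<exists>r::real \<Rightarrow> int. (r = floor \<or> r = ceiling) \<and>
    (\<forall>n. r (\<rho> + real (Suc n) * \<alpha>) - r (\<rho> + real n * \<alpha>) = (if s n = Letter_a then 1 else 0))"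
    using s
  proof
    assume s: "s = sturmian_left_closed \<alpha> \<rho>"
    have "\<lfloor>x + \<alpha>\<rfloor> - \<lfloor>x\<rfloor> = (if frac x < 1 - \<alpha> then 0 else 1)" for x
      using \<alpha> unfolding frac_def by (auto intro!: floor_unique simp: diff_eq_eq) linarith+
    from this[of "\<rho> + real n * \<alpha>" for n] show ?thesis
      by (intro exI[of _ floor]) (simp add: s sturmian_left_closed_def algebra_simps)
  next
    assume s: "s = sturmian_right_closed \<alpha> \<rho>"
    have "\<lceil>x + \<alpha>\<rceil> - \<lceil>x\<rceil> = (if 0 < frac x \<and> frac x \<le> 1 - \<alpha> then 0 else 1)" for x
    proof (cases "frac x = 0")
      \<comment> \<open>At an integer point the ceiling jumps at once, in agreement with the coding
        of 0 by a.\<close>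
      case True
      then have "x = of_int \<lfloor>x\<rfloor>"
        by (simp add: frac_def)
      then obtain z where "x = of_int z" ..
      then show ?thesis
        using \<alpha> by (auto intro!: ceiling_unique simp: diff_eq_eq)
    next
      case False
      then have "frac x > 0"
        using frac_ge_0[of x] by linarith
      then have "of_int \<lfloor>x\<rfloor> < x"
        by (simp add: frac_def)
      then have "\<lceil>x\<rceil> = \<lfloor>x\<rfloor> + 1"
        by linarith
      then show ?thesis
        using \<alpha> \<open>frac x > 0\<close> unfolding frac_def
        by (auto intro!: ceiling_unique simp: diff_eq_eq) linarith+
    qed
    from this[of "\<rho> + real n * \<alpha>" for n] show ?thesis
      by (intro exI[of _ ceiling]) (simp add: s sturmian_right_closed_def algebra_simps)
  qed
  then obtain r :: "real \<Rightarrow> int" where r: "r = floor \<or> r = ceiling" and step: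
    "\<And>n. r (\<rho> + real (Suc n) * \<alpha>) - r (\<rho> + real n * \<alpha>) = (if s n = Letter_a then 1 else 0)"
    by blast
  have "int (count_list (map s [i..<i + n]) Letter_a)
      = r (\<rho> + real (i + n) * \<alpha>) - r (\<rho> + real i * \<alpha>)" for i n
  proof (induction n)
    case (Suc n)
    then show ?case
      using step[of "i + n"] by (auto split: if_splits)
  qed simp
  with r show ?thesis
    by (rule that)
qed

text \<open>Take for \<open>p\<close> the number of letters a in one block. The whole power contains
  \<open>k * p\<close> of them, and rounding keeps this count strictly within 1 of
  \<open>k * m * \<alpha>\<close>.\<close>

lemma abelian_power_sturmian_bound:
  assumes "sturmian_word \<alpha> \<rho> s" "is_factor w s" "abelian_power m k w"
  obtains p :: int where "real k * \<bar>real m * \<alpha> - of_int p\<bar> < 1"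
proof -
  obtain r :: "real \<Rightarrow> int" where r: "r = floor \<or> r = ceiling" and count:
    "\<And>i n. int (count_list (map s [i..<i + n]) Letter_a)
       = r (\<rho> + real (i + n) * \<alpha>) - r (\<rho> + real i * \<alpha>)"
    by (rule count_letter_a_sturmian[OF assms(1)]) (use that in blast)
  obtain us P where us: "w = concat us" "length us = k" "\<forall>u\<in>set us. length u = m \<and> parikh u = P"
    using assms(3) unfolding abelian_power_def by blast
  obtain i where i: "w = map s [i..<i + length w]"
    using assms(2) unfolding is_factor_def by blast
  have len: "length w = k * m"
    using us length_concat_blocks by blast
  have "count_list (concat us) Letter_a = length us * fst P"
    using us(3) by (induction us) (auto simp: parikh_def)
  then have "int (k * fst P) = r (\<rho> + real (i + k * m) * \<alpha>) - r (\<rho> + real i * \<alpha>)"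
    using count[of i "k * m"] i us(1,2) len by simp
  moreover have "\<bar>of_int (r y - r x) - (y - x)\<bar> < 1" for x y
    using r by (auto; linarith)
  ultimately have "\<bar>of_int (int (k * fst P)) - ((\<rho> + real (i + k * m) * \<alpha>) - (\<rho> + real i * \<alpha>))\<bar> < 1"
    by metis
  also have "of_int (int (k * fst P)) - ((\<rho> + real (i + k * m) * \<alpha>) - (\<rho> + real i * \<alpha>))
      = - (real k * (real m * \<alpha> - of_int (int (fst P))))"
    by (simp add: algebra_simps)
  finally have "real k * \<bar>real m * \<alpha> - of_int (int (fst P))\<bar> < 1"
    by (simp add: abs_mult)
  then show ?thesis
    by (rule that)
qed

text \<open>Kronecker's theorem for an orbit starting at \<rho>, aimed at the midpoint of the
  interval moved back by \<rho>.\<close>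

lemma frac_rotation_dense:
  assumes "\<alpha> \<notin> \<rat>" "0 \<le> a" "a < b" "b \<le> 1"
  obtains i :: nat where "a < frac (\<rho> + real i * \<alpha>)" "frac (\<rho> + real i * \<alpha>) < b"
proof -
  define c where "c = (a + b) / 2"
  obtain i :: nat where i: "\<bar>frac (real i * \<alpha>) - frac (c - \<rho>)\<bar> < (b - a) / 2"
    using Kronecker_approx_1_explicit[of \<alpha> "frac (c - \<rho>)" "(b - a) / 2"] assms
    by (metis diff_gt_0_iff_gt frac_ge_0 frac_lt_1 half_gt_zero order_less_imp_le)
  \<comment> \<open>The representative modulo 1 of the orbit point that lies near \<open>c\<close>;
    being in the unit interval, it is the fractional part.\<close>
  define t where "t = c + (frac (real i * \<alpha>) - frac (c - \<rho>))"
  have t: "a < t" "t < b"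
    using i c_def unfolding t_def abs_less_iff by argo+
  have "\<rho> + real i * \<alpha> - t = of_int (\<lfloor>real i * \<alpha>\<rfloor> - \<lfloor>c - \<rho>\<rfloor>)"
    by (simp add: t_def frac_def)
  then have "\<rho> + real i * \<alpha> - t \<in> \<int>"
    by simp
  then have "frac (\<rho> + real i * \<alpha>) = t"
    using t assms by (simp add: frac_unique_iff)
  with t show ?thesis
    using that[of i] by simp
qed

text \<open>A suitable starting point keeps all \<open>x + j * t\<close> with
  \<open>j \<le> k\<close> strictly between the same two integers. Rounding then ignores the drift
  \<open>t\<close>, and each block has exactly \<open>p\<close> letters a.\<close>

lemma le_max_power_exponent_sturmian:
  assumes "sturmian_word \<alpha> \<rho> s" and km: "real k * \<bar>real m * \<alpha> - of_int p\<bar> < 1"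
  shows "of_nat k \<le> max_power_exponent s m"
proof -
  have irr: "\<alpha> \<notin> \<rat>"
    using assms(1) by (simp add: sturmian_word_def)
  obtain r :: "real \<Rightarrow> int" where r: "r = floor \<or> r = ceiling" and count:
    "\<And>i n. int (count_list (map s [i..<i + n]) Letter_a)
       = r (\<rho> + real (i + n) * \<alpha>) - r (\<rho> + real i * \<alpha>)"
    by (rule count_letter_a_sturmian[OF assms(1)]) (use that in blast)
  define t where "t = real m * \<alpha> - of_int p"
  have kt: "\<bar>real k * t\<bar> < 1"
    using km by (simp add: t_def abs_mult)
  \<comment> \<open>The interval consists of the \<open>y\<close> for which \<open>y\<close> and
    \<open>y + k * t\<close> both lie in (0,1); it is nonempty because
    \<open>\<bar>k * t\<bar> < 1\<close>.\<close>
  obtain i :: nat where i: "max 0 (- (real k * t)) < frac (\<rho> + real i * \<alpha>)"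
    "frac (\<rho> + real i * \<alpha>) < min 1 (1 - real k * t)"
    by (rule frac_rotation_dense[OF irr, of "max 0 (- (real k * t))" "min 1 (1 - real k * t)" \<rho>])
       (use kt in auto)
  define x where "x = \<rho> + real i * \<alpha>"
  have x: "0 < frac x" "frac x < 1" "- (real k * t) < frac x" "frac x < 1 - real k * t"
    using i unfolding x_def by linarith+
  have rx: "r (x + real j * t) = r x" if "j \<le> k" for j
  proof -
    have "0 < frac x + real j * t \<and> frac x + real j * t < 1"
    proof (cases "t \<ge> 0")
      case True
      then have "0 \<le> real j * t" "real j * t \<le> real k * t"
        using that by (auto intro: mult_right_mono)
      then show ?thesis
        using x by linarith
    next
      case False
      then have "real j * t \<le> 0" "real k * t \<le> real j * t"
        using that by (auto intro: mult_right_mono_neg simp: mult_nonneg_nonpos)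
      then show ?thesis
        using x by linarith
    qed
    then have "\<lfloor>x + real j * t\<rfloor> = \<lfloor>x\<rfloor>" "\<lceil>x + real j * t\<rceil> = \<lfloor>x\<rfloor> + 1" "\<lceil>x\<rceil> = \<lfloor>x\<rfloor> + 1"
      using x(1,2) unfolding frac_def by - linarith+
    then show ?thesis
      using r by auto
  qed
  \<comment> \<open>A block of \<open>m\<close> rotation steps is a shift by \<open>t\<close> plus
    the integer \<open>p\<close>, and \<open>r\<close> commutes with integer shifts.\<close>
  have rj: "r (\<rho> + real (i + j * m) * \<alpha>) = r x + int j * p" if "j \<le> k" for j
  proof -
    have "\<rho> + real (i + j * m) * \<alpha> = (x + real j * t) + of_int (int j * p)"
      by (simp add: x_def t_def algebra_simps)
    moreover have "r (y + of_int z) = r y + z" for y z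
      using r by auto
    ultimately show ?thesis
      using rx[OF that] by metis
  qed
  define u where "u = (\<lambda>j. map s [i + j * m..<i + j * m + m])"
  have count_u: "int (count_list (u j) Letter_a) = p" if "j < k" for j
  proof -
    have "i + j * m + m = i + Suc j * m"
      by simp
    then have "int (count_list (u j) Letter_a)
        = r (\<rho> + real (i + Suc j * m) * \<alpha>) - r (\<rho> + real (i + j * m) * \<alpha>)"
      using count[of "i + j * m" m] unfolding u_def by metis
    also have "\<dots> = (r x + int (Suc j) * p) - (r x + int j * p)"
      by (simp only: rj Suc_leI less_imp_le that)
    finally show ?thesis
      by (simp add: algebra_simps)
  qed
  have parikh_u: "parikh (u j) = (nat p, m - nat p)" if "j < k" for j
  proof -
    have "fst (parikh (u j)) = nat p"
      using count_u[OF that] by (simp add: parikh_def)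
    moreover have "fst (parikh (u j)) + snd (parikh (u j)) = m"
      using length_eq_parikh_norm[of "u j"] by (simp add: parikh_norm_def u_def)
    ultimately show ?thesis
      by (metis add_diff_cancel_left' prod.collapse)
  qed
  have concat_u: "concat (map u [0..<n]) = map s [i..<i + n * m]" for n
  proof (induction n)
    case (Suc n)
    have "[i..<i + Suc n * m] = [i..<i + n * m] @ [i + n * m..<i + n * m + m]"
      using upt_add_eq_append[of i "i + n * m" m] by (simp add: add_ac)
    then show ?case
      using Suc by (simp add: u_def)
  qed simp
  have "is_factor (concat (map u [0..<k])) s"
    unfolding is_factor_def by (intro exI[of _ i]) (simp add: concat_u)
  moreover have "abelian_power m k (concat (map u [0..<k]))"
    unfolding abelian_power_def
    by (intro exI[of _ "map u [0..<k]"] exI[of _ "(nat p, m - nat p)"])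
       (auto simp: parikh_u, simp add: u_def)
  ultimately show ?thesis
    unfolding max_power_exponent_def by (intro SUP_upper) auto
qed

section \<open>Upper bound for the critical exponent\<close>

lemma abelian_critical_exponent_le:
  assumes "sturmian_word \<alpha> \<rho> s" "quadratic_disc5 \<alpha>"
  shows "abelian_critical_exponent s \<le> ennreal (sqrt 5)"
proof -
  obtain K :: nat where K: "\<And>(m :: nat) (k :: nat) (p :: int).
    m > 0 \<Longrightarrow> real k * \<bar>real m * \<alpha> - of_int p\<bar> < 1 \<Longrightarrow> real k \<le> real m * sqrt 5 + real K"
    by (rule quadratic_disc5_approximation[OF assms(2)]) (use that in blast)
  have "max_power_exponent s m \<le> of_nat m * ennreal (sqrt 5) + of_nat K" if "m > 0" for m
    unfolding max_power_exponent_def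
  proof (rule SUP_least, clarify)
    fix k w
    assume "is_factor w s" "abelian_power m k w"
    then obtain p :: int where "real k * \<bar>real m * \<alpha> - of_int p\<bar> < 1"
      using abelian_power_sturmian_bound[OF assms(1)] by blast
    then have "ennreal (real k) \<le> ennreal (real m * sqrt 5 + real K)"
      using K[OF that] by (intro ennreal_leI)
    then show "of_nat k \<le> of_nat m * ennreal (sqrt 5) + of_nat K"
      by (simp add: ennreal_of_nat_eq_real_of_nat ennreal_plus ennreal_mult)
  qed
  then have "abelian_critical_exponent s \<le> limsup (\<lambda>m. of_nat m * ennreal (sqrt 5) / of_nat m)"
    unfolding abelian_critical_exponent_def by (rule limsup_divide_of_nat_le)
  also have "\<dots> = limsup (\<lambda>m. ennreal (sqrt 5))"
  proof (rule Limsup_eq)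
    show "\<forall>\<^sub>F m in sequentially. of_nat m * ennreal (sqrt 5) / of_nat m = ennreal (sqrt 5)"
      using eventually_gt_at_top[of 0]
    proof eventually_elim
      case (elim m)
      then show ?case
        by (simp add: ennreal_of_nat_eq_real_of_nat divide_ennreal flip: ennreal_mult')
    qed
  qed
  also have "\<dots> = ennreal (sqrt 5)"
    by (simp add: Limsup_const)
  finally show ?thesis .
qed

section \<open>Good approximations from the Gauss map\<close>

primrec complete_quotient :: "real \<Rightarrow> nat \<Rightarrow> real" where
  "complete_quotient \<alpha> 0 = \<alpha>"
| complete_quotient_Suc: "complete_quotient \<alpha> (Suc n) = 1 / frac (complete_quotient \<alpha> n)"

declare complete_quotient_Suc [simp del]

definition partial_quotient :: "real \<Rightarrow> nat \<Rightarrow> int" where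
  "partial_quotient \<alpha> n = \<lfloor>complete_quotient \<alpha> n\<rfloor>"

text \<open>
  Indices are shifted by one against the usual convention, so that the recursions start from
  $p_{-1} = 1$, $p_0 = a_0$ and $q_{-1} = 0$, $q_0 = 1$.
\<close>

fun cf_num :: "real \<Rightarrow> nat \<Rightarrow> int" where
  "cf_num \<alpha> 0 = 1"
| "cf_num \<alpha> (Suc 0) = partial_quotient \<alpha> 0"
| "cf_num \<alpha> (Suc (Suc n)) = partial_quotient \<alpha> (Suc n) * cf_num \<alpha> (Suc n) + cf_num \<alpha> n"

fun cf_denom :: "real \<Rightarrow> nat \<Rightarrow> int" where
  "cf_denom \<alpha> 0 = 0"
| "cf_denom \<alpha> (Suc 0) = 1"
| "cf_denom \<alpha> (Suc (Suc n)) = partial_quotient \<alpha> (Suc n) * cf_denom \<alpha> (Suc n) + cf_denom \<alpha> n"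

lemma frac_gt_0_irrational: "x \<notin> \<rat> \<Longrightarrow> frac x > 0"
  using Ints_subset_Rats by (auto simp: frac_gt_0_iff)

context
  fixes \<alpha> :: real
  assumes irrational: "\<alpha> \<notin> \<rat>"
begin

lemma complete_quotient_irrational: "complete_quotient \<alpha> n \<notin> \<rat>"
proof (induction n)
  case (Suc n)
  show ?case
  proof
    assume "complete_quotient \<alpha> (Suc n) \<in> \<rat>"
    then have "1 / complete_quotient \<alpha> (Suc n) + of_int \<lfloor>complete_quotient \<alpha> n\<rfloor> \<in> \<rat>"
      by (intro Rats_add Rats_divide) auto
    then show False
      using Suc by (simp add: complete_quotient_Suc frac_def)
  qed
qed (simp add: irrational)

lemma complete_quotient_gt_1: "complete_quotient \<alpha> (Suc n) > 1"
  using frac_gt_0_irrational[OF complete_quotient_irrational, of n] frac_lt_1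
  by (simp add: complete_quotient_Suc)

lemma complete_quotient_step:
  "complete_quotient \<alpha> n = of_int (partial_quotient \<alpha> n) + 1 / complete_quotient \<alpha> (Suc n)"
  by (simp add: complete_quotient_Suc partial_quotient_def frac_def)

lemma partial_quotient_ge_1: "partial_quotient \<alpha> (Suc n) \<ge> 1"
  using complete_quotient_gt_1[of n] unfolding partial_quotient_def by linarith

text \<open>Growth with \<open>n\<close> supplies the arbitrarily large periods that a limsup
  requires; the bound by 1 permits division.\<close>

lemma cf_denom_ge: "cf_denom \<alpha> (Suc n) \<ge> 1 \<and> cf_denom \<alpha> (Suc n) \<ge> int n"
proof (induction n rule: induct_nat_012)
  case 1
  then show ?case
    using partial_quotient_ge_1[of 0] by simp
next
  case (ge2 n)
  have "1 * cf_denom \<alpha> (Suc (Suc n)) \<le> partial_quotient \<alpha> (Suc (Suc n)) * cf_denom \<alpha> (Suc (Suc n))"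
    using ge2 partial_quotient_ge_1 by (intro mult_right_mono) auto
  then show ?case
    using ge2 cf_denom.simps(3)[of \<alpha> "Suc n"] by linarith
qed simp

lemma cf_denom_nonneg: "cf_denom \<alpha> n \<ge> 0"
  using cf_denom_ge[of "n - 1"] by (cases n) auto

text \<open>Errors satisfy the same linear recursion as numerators and denominators, so the negated
  ratio of successive errors follows the recursion of the complete quotients.\<close>

lemma cf_error_step:
  "(of_int (cf_denom \<alpha> (Suc n)) * \<alpha> - of_int (cf_num \<alpha> (Suc n))) * complete_quotient \<alpha> (Suc n)
    = - (of_int (cf_denom \<alpha> n) * \<alpha> - of_int (cf_num \<alpha> n))"
proof (induction n)
  case 0
  then show ?case
    using frac_gt_0_irrational[OF irrational] by (simp add: complete_quotient_Suc partial_quotient_def frac_def)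
next
  case (Suc n)
  define E where "E = (\<lambda>n. of_int (cf_denom \<alpha> n) * \<alpha> - of_int (cf_num \<alpha> n))"
  define x where "x = complete_quotient \<alpha>"
  have x: "x (Suc n) = of_int (partial_quotient \<alpha> (Suc n)) + 1 / x (Suc (Suc n))"
    "x (Suc (Suc n)) > 1"
    unfolding x_def using complete_quotient_step complete_quotient_gt_1 by blast+
  have "E (Suc (Suc n)) = of_int (partial_quotient \<alpha> (Suc n)) * E (Suc n) + E n"
    by (simp add: E_def algebra_simps)
  also have "E n = - E (Suc n) * x (Suc n)"
    using Suc unfolding E_def x_def by linarith
  finally have "E (Suc (Suc n)) = - E (Suc n) / x (Suc (Suc n))"
    by (simp add: x(1) algebra_simps)
  then have "E (Suc (Suc n)) * x (Suc (Suc n)) = - E (Suc n)"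
    using x(2) by simp
  then show ?case
    by (simp only: E_def x_def)
qed

text \<open>The product is invariant: passing to the next index divides the error by the next
  complete quotient and multiplies the other factor by it.\<close>

lemma cf_error:
  "\<bar>of_int (cf_denom \<alpha> (Suc n)) * \<alpha> - of_int (cf_num \<alpha> (Suc n))\<bar> *
    (of_int (cf_denom \<alpha> (Suc n)) * complete_quotient \<alpha> (Suc n) + of_int (cf_denom \<alpha> n)) = 1"
proof (induction n)
  case 0
  then show ?case
    using frac_gt_0_irrational[OF irrational] by (simp add: complete_quotient_Suc partial_quotient_def frac_def)
next
  case (Suc n)
  define e where "e = (\<lambda>n. \<bar>of_int (cf_denom \<alpha> n) * \<alpha> - of_int (cf_num \<alpha> n)\<bar>)"
  define x where "x = complete_quotient \<alpha>"
  define q where "q = (\<lambda>n. real_of_int (cf_denom \<alpha> n))"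
  define a where "a = real_of_int (partial_quotient \<alpha> (Suc n))"
  have x: "x (Suc n) = a + 1 / x (Suc (Suc n))" "x (Suc (Suc n)) > 1"
    unfolding x_def a_def using complete_quotient_step complete_quotient_gt_1 by blast+
  have q: "q (Suc (Suc n)) = a * q (Suc n) + q n"
    by (simp add: q_def a_def)
  have e: "e (Suc (Suc n)) * x (Suc (Suc n)) = e (Suc n)"
    using arg_cong[OF cf_error_step[of "Suc n"], of abs] x(2)
    unfolding e_def x_def by (simp only: abs_mult abs_minus_cancel abs_of_pos)
  have "q (Suc (Suc n)) * x (Suc (Suc n)) + q (Suc n)
      = x (Suc (Suc n)) * (q (Suc n) * x (Suc n) + q n)"
    using x(2) by (simp add: q x(1) field_simps)
  then have "e (Suc (Suc n)) * (q (Suc (Suc n)) * x (Suc (Suc n)) + q (Suc n))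
      = e (Suc n) * (q (Suc n) * x (Suc n) + q n)"
    using e by (metis mult.assoc)
  then show ?case
    using Suc unfolding e_def x_def q_def by simp
qed

section \<open>Ratios of consecutive denominators and the Lagrange constant\<close>

lemma denom_ratio_nonneg: "real_of_int (cf_denom \<alpha> n) / of_int (cf_denom \<alpha> (Suc n)) \<ge> 0"
  using cf_denom_nonneg by simp

text \<open>Iterated, this is the expansion read backwards: the ratio equals
  \<open>[0; a_(n+1), ..., a_1]\<close>.\<close>

lemma denom_ratio_Suc:
  "real_of_int (cf_denom \<alpha> (Suc n)) / of_int (cf_denom \<alpha> (Suc (Suc n)))
    = 1 / (of_int (partial_quotient \<alpha> (Suc n)) + of_int (cf_denom \<alpha> n) / of_int (cf_denom \<alpha> (Suc n)))"
proof -
  have "real_of_int (cf_denom \<alpha> (Suc n)) \<ge> 1"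
    using cf_denom_ge[of n] by simp
  then show ?thesis
    by (simp add: field_simps)
qed

lemma denom_ratio_le_1: "real_of_int (cf_denom \<alpha> n) / of_int (cf_denom \<alpha> (Suc n)) \<le> 1"
proof (cases n)
  case (Suc k)
  have "real_of_int (partial_quotient \<alpha> (Suc k)) \<ge> 1"
    using partial_quotient_ge_1[of k] by simp
  then show ?thesis
    unfolding Suc denom_ratio_Suc using denom_ratio_nonneg[of k] by simp
qed simp

text \<open>The period \<open>m\<close> is a convergent denominator. The reciprocal \<open>T\<close>
  of its error is \<open>m\<close> times the sum in the hypothesis, and some admissible exponent is
  at least \<open>T - 1\<close>. The loss \<open>1 / m\<close> is absorbed by
  \<open>e\<close>.\<close>

lemma abelian_critical_exponent_ge:
  assumes s: "sturmian_word \<alpha> \<rho> s"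
    and freq: "\<exists>\<^sub>F n in sequentially. L \<le> complete_quotient \<alpha> (Suc n)
      + of_int (cf_denom \<alpha> n) / of_int (cf_denom \<alpha> (Suc n))"
  shows "ennreal L \<le> abelian_critical_exponent s"
proof (rule ennreal_le_epsilon)
  fix e :: real
  assume e: "e > 0"
  define f where "f = (\<lambda>m. max_power_exponent s m / of_nat m)"
  have large: "\<exists>m\<ge>N. ennreal (L - e) \<le> f m" for N
  proof -
    obtain M :: nat where M: "1 / e < real M"
      using reals_Archimedean2 by blast
    obtain n where n: "n \<ge> max N M" and Ln: "L \<le> complete_quotient \<alpha> (Suc n)
        + of_int (cf_denom \<alpha> n) / of_int (cf_denom \<alpha> (Suc n))"
      using freq unfolding frequently_sequentially by blast
    define x where "x = complete_quotient \<alpha> (Suc n)"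
    define m where "m = nat (cf_denom \<alpha> (Suc n))"
    define d where "d = \<bar>real m * \<alpha> - of_int (cf_num \<alpha> (Suc n))\<bar>"
    define T where "T = real m * x + of_int (cf_denom \<alpha> n)"
    have m: "real_of_int (cf_denom \<alpha> (Suc n)) = real m" "m \<ge> 1" "m \<ge> n"
      using cf_denom_ge[of n] by (auto simp: m_def)
    have dT: "d * T = 1"
      using cf_error[of n] by (simp add: d_def T_def x_def m)
    have "x > 1"
      unfolding x_def by (rule complete_quotient_gt_1)
    then have "real m * x > 0"
      using m by simp
    then have T: "T > 0"
      unfolding T_def using cf_denom_nonneg[of n] by (smt (verit) of_int_0_le_iff)
    have "d > 0"
      using dT T by (metis zero_less_mult_pos2 zero_less_one)
    \<comment> \<open>The largest integer strictly below \<open>T\<close>; the floor would violate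
      \<open>k * d < 1\<close> when \<open>T\<close> is an integer.\<close>
    define k where "k = nat (\<lceil>T\<rceil> - 1)"
    have k: "real k < T" "T - 1 \<le> real k"
      using T unfolding k_def by linarith+
    have "real k * d < 1"
      using mult_strict_right_mono[OF k(1) \<open>d > 0\<close>] dT by (simp add: mult.commute)
    then have kmax: "of_nat k \<le> max_power_exponent s m"
      unfolding d_def by (rule le_max_power_exponent_sturmian[OF s])
    have "1 < e * real M"
      using M e by (simp add: field_simps)
    also have "\<dots> \<le> e * real m"
      using m n e by (intro mult_left_mono) auto
    finally have em: "1 < e * real m" .
    have "L * real m \<le> (x + of_int (cf_denom \<alpha> n) / real m) * real m"
      using Ln unfolding m(1) x_def by (rule mult_right_mono) simp
    also have "\<dots> = T"
      using m(2) by (simp add: T_def field_simps)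
    finally have "L * real m \<le> T" .
    then have "(L - e) * real m \<le> real k"
      using k em by (simp add: left_diff_distrib)
    then have "L - e \<le> real k / real m"
      using m by (simp add: field_simps)
    then have "ennreal (L - e) \<le> ennreal (real k / real m)"
      by (rule ennreal_leI)
    also have "\<dots> = of_nat k / of_nat m"
      using m by (simp add: ennreal_of_nat_eq_real_of_nat divide_ennreal)
    also have "\<dots> \<le> f m"
      unfolding f_def by (intro divide_right_mono_ennreal kmax)
    finally show ?thesis
      using m n by (intro exI[of _ m]) auto
  qed
  have "ennreal (L - e) \<le> limsup f"
  proof (rule ccontr)
    assume "\<not> ?thesis"
    then have "\<forall>\<^sub>F m in sequentially. f m < ennreal (L - e)"
      by (intro Limsup_lessD) auto
    then show False
      using large unfolding eventually_sequentially by (meson leD)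
  qed
  then have "ennreal (L - e) + ennreal e \<le> limsup f + ennreal e"
    by (rule add_right_mono)
  \<comment> \<open>Only an inequality, as \<open>ennreal\<close> truncates a negative
    \<open>L - e\<close> to 0.\<close>
  moreover have "ennreal L \<le> ennreal (L - e) + ennreal e"
    using e by (cases "L - e \<ge> 0") (auto simp: ennreal_neg intro: ennreal_leI simp flip: ennreal_plus)
  ultimately show "ennreal L \<le> abelian_critical_exponent s + ennreal e"
    unfolding abelian_critical_exponent_def f_def by order
qed

section \<open>The two cases of the lower bound\<close>

lemma complete_quotient_tail_ones:
  assumes "\<And>n. n \<ge> N \<Longrightarrow> partial_quotient \<alpha> n = 1" "n \<ge> N"
  shows "complete_quotient \<alpha> n = golden_ratio"
proof -
  have step: "1 + 1 / complete_quotient \<alpha> (Suc (n + i)) = complete_quotient \<alpha> (n + i)" for i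
    using complete_quotient_step[of "n + i"] assms by simp
  have "has_cf_expansion (complete_quotient \<alpha> (n + 0)) (\<lambda>_. 1)"
    by (rule has_cf_expansionI[of "\<lambda>i. complete_quotient \<alpha> (n + i)"])
       (simp_all add: step complete_quotient_gt_1 less_imp_le)
  moreover have "has_cf_expansion golden_ratio (\<lambda>_. 1)"
    using has_cf_expansionI[of "\<lambda>_. golden_ratio" "\<lambda>_. 1"] golden_ratio_fixed_point
      golden_ratio_gt_1 by simp
  ultimately show ?thesis
    using has_cf_expansion_unique by simp
qed

lemma cf_equivalent_golden_ratioI:
  assumes "\<And>n. n \<ge> N \<Longrightarrow> partial_quotient \<alpha> n = 1"
  shows "cf_equivalent \<alpha> (golden_ratio - 1)"
proof -
  have "has_cf_expansion (complete_quotient \<alpha> 0) (partial_quotient \<alpha>)"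
    using complete_quotient_step complete_quotient_gt_1 partial_quotient_ge_1 less_imp_le
    by (intro has_cf_expansionI) blast+
  \<comment> \<open>The expansion \<open>[0; 1, 1, ...]\<close>. The unevaluated
    \<open>case 0\<close> matches the \<open>x 0\<close> of the introduction rule.\<close>
  moreover have "has_cf_expansion (case 0 of 0 \<Rightarrow> golden_ratio - 1 | Suc _ \<Rightarrow> golden_ratio)
      (\<lambda>n. if n = 0 then 0 else 1)"
    by (rule has_cf_expansionI[of "\<lambda>n. case n of 0 \<Rightarrow> golden_ratio - 1 | Suc _ \<Rightarrow> golden_ratio"])
       (use golden_ratio_fixed_point golden_ratio_gt_1 in \<open>auto split: nat.splits\<close>)
  \<comment> \<open>The shift by 1 skips the leading coefficient 0.\<close>
  moreover have "partial_quotient \<alpha> (N + i) = (if 1 + i = 0 then 0 else 1)" for i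
    using assms by simp
  ultimately show ?thesis
    unfolding cf_equivalent_def complete_quotient.simps(1) nat.case(1) by blast
qed

text \<open>
  The map $r \mapsto 1/(1+r)$ exchanges the two sides of its fixed point $1/\phi$, so at
  least every other ratio of consecutive denominators is at least $1/\phi$.
\<close>

lemma lagrange_frequently_ge_sqrt5:
  assumes ones: "\<And>n. n \<ge> N \<Longrightarrow> partial_quotient \<alpha> n = 1"
  shows "\<exists>\<^sub>F n in sequentially. sqrt 5 \<le> complete_quotient \<alpha> (Suc n)
      + of_int (cf_denom \<alpha> n) / of_int (cf_denom \<alpha> (Suc n))"
  unfolding frequently_sequentially
proof
  fix M
  define n where "n = max N M"
  define r where "r = (\<lambda>n. real_of_int (cf_denom \<alpha> n) / of_int (cf_denom \<alpha> (Suc n)))"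
  have g: "1 / (1 + (golden_ratio - 1)) = golden_ratio - 1"
    using golden_ratio_fixed_point by (simp add: algebra_simps)
  have g5: "golden_ratio + (golden_ratio - 1) = sqrt 5"
    by (simp add: golden_ratio_def field_simps)
  have "r n \<ge> golden_ratio - 1 \<or> r (Suc n) \<ge> golden_ratio - 1"
  proof (rule disjCI)
    assume "\<not> r (Suc n) \<ge> golden_ratio - 1"
    moreover have "r (Suc n) = 1 / (1 + r n)"
      unfolding r_def denom_ratio_Suc using ones[of "Suc n"] by (simp add: n_def)
    ultimately have less: "1 / (1 + r n) < 1 / (1 + (golden_ratio - 1))"
      unfolding g by simp
    have "r n \<ge> 0"
      unfolding r_def by (rule denom_ratio_nonneg)
    with less golden_ratio_gt_1 show "r n \<ge> golden_ratio - 1"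
      by (simp add: field_simps)
  qed
  moreover have golden: "complete_quotient \<alpha> k = golden_ratio" if "N \<le> k" for k
    by (rule complete_quotient_tail_ones[OF _ that]) (rule ones)
  have "N \<le> n"
    by (simp add: n_def)
  then have "complete_quotient \<alpha> (Suc n) = golden_ratio"
    "complete_quotient \<alpha> (Suc (Suc n)) = golden_ratio"
    by (simp_all add: golden)
  ultimately have "sqrt 5 \<le> complete_quotient \<alpha> (Suc n) + r n
      \<or> sqrt 5 \<le> complete_quotient \<alpha> (Suc (Suc n)) + r (Suc n)"
    using g5 by auto
  then show "\<exists>n\<ge>M. sqrt 5 \<le> complete_quotient \<alpha> (Suc n)
      + of_int (cf_denom \<alpha> n) / of_int (cf_denom \<alpha> (Suc n))"
    unfolding r_def
  proof
    show ?thesis if "sqrt 5 \<le> complete_quotient \<alpha> (Suc n)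
        + of_int (cf_denom \<alpha> n) / of_int (cf_denom \<alpha> (Suc n))"
      using that by (intro exI[of _ n]) (simp only: n_def max.cobounded2)
    show ?thesis if "sqrt 5 \<le> complete_quotient \<alpha> (Suc (Suc n))
        + of_int (cf_denom \<alpha> (Suc n)) / of_int (cf_denom \<alpha> (Suc (Suc n)))"
      using that by (intro exI[of _ "Suc n"]) (simp only: n_def le_SucI max.cobounded2)
  qed
qed

text \<open>A partial quotient of at least 3 suffices alone. If eventually all are at most 2, then
  at each later 2 the complete quotient is at least \<open>2 + 1/3\<close> and the denominator ratio
  at least \<open>1 / (2 + 1)\<close>.\<close>

lemma lagrange_frequently_ge_8_3:
  assumes "\<exists>\<^sub>F n in sequentially. partial_quotient \<alpha> (Suc n) \<noteq> 1"
  shows "\<exists>\<^sub>F n in sequentially. 8 / 3 \<le> complete_quotient \<alpha> (Suc n)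
      + of_int (cf_denom \<alpha> n) / of_int (cf_denom \<alpha> (Suc n))"
proof (cases "\<exists>\<^sub>F n in sequentially. partial_quotient \<alpha> (Suc n) \<ge> 3")
  case True
  then show ?thesis
  proof (rule frequently_elim1)
    fix n
    assume "partial_quotient \<alpha> (Suc n) \<ge> 3"
    then have "complete_quotient \<alpha> (Suc n) \<ge> 3"
      by (simp add: partial_quotient_def le_floor_iff)
    then show "8 / 3 \<le> complete_quotient \<alpha> (Suc n)
        + of_int (cf_denom \<alpha> n) / of_int (cf_denom \<alpha> (Suc n))"
      using denom_ratio_nonneg[of n] by linarith
  qed
next
  case False
  then obtain N where "\<And>n. n \<ge> N \<Longrightarrow> \<not> 3 \<le> partial_quotient \<alpha> (Suc n)"
    by (auto simp: frequently_def eventually_sequentially)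
  then have N: "partial_quotient \<alpha> (Suc n) \<le> 2" if "n \<ge> N" for n
    using that by force
  show ?thesis
    unfolding frequently_sequentially
  proof
    fix M
    \<comment> \<open>The extra \<open>Suc\<close> leaves room for the predecessor
      \<open>k \<ge> N\<close>, where the bound 2 is used in the denominator ratio.\<close>
    obtain n where n: "n \<ge> Suc (max N M)" "partial_quotient \<alpha> (Suc n) \<noteq> 1"
      using assms unfolding frequently_sequentially by blast
    then obtain k where k: "n = Suc k" "k \<ge> N"
      by (cases n) auto
    have "real_of_int (partial_quotient \<alpha> (Suc n)) \<ge> 2"
      using n partial_quotient_ge_1[of n] by simp
    moreover have "complete_quotient \<alpha> (Suc (Suc n)) \<le> 3"
      using N[of "Suc n"] n unfolding partial_quotient_def by linarith
    then have "1 / complete_quotient \<alpha> (Suc (Suc n)) \<ge> 1 / 3"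
      using complete_quotient_gt_1[of "Suc n"] by (intro divide_left_mono) auto
    ultimately have "complete_quotient \<alpha> (Suc n) \<ge> 7 / 3"
      using complete_quotient_step[of "Suc n"] by linarith
    moreover have "1 / (of_int (partial_quotient \<alpha> (Suc k))
        + real_of_int (cf_denom \<alpha> k) / of_int (cf_denom \<alpha> (Suc k))) \<ge> 1 / (2 + 1)"
      using N[OF k(2)] partial_quotient_ge_1[of k] denom_ratio_nonneg[of k]
      by (intro divide_left_mono add_mono denom_ratio_le_1 mult_pos_pos add_pos_nonneg) auto
    then have "real_of_int (cf_denom \<alpha> n) / of_int (cf_denom \<alpha> (Suc n)) \<ge> 1 / 3"
      unfolding k(1) denom_ratio_Suc by simp
    ultimately show "\<exists>n\<ge>M. 8 / 3 \<le> complete_quotient \<alpha> (Suc n)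
        + of_int (cf_denom \<alpha> n) / of_int (cf_denom \<alpha> (Suc n))"
      using n by (intro exI[of _ n]) auto
  qed
qed

end

section \<open>Combination of the bounds\<close>

text \<open>The strict second alternative, from \<open>8/3 > sqrt 5\<close>, is what shows that
  equality forces equivalence to \<open>golden_ratio - 1\<close>.\<close>

lemma abelian_critical_exponent_ge_cases:
  assumes "sturmian_word \<alpha> \<rho> s"
  shows "abelian_critical_exponent s \<ge> ennreal (sqrt 5) \<and> cf_equivalent \<alpha> (golden_ratio - 1)
    \<or> abelian_critical_exponent s > ennreal (sqrt 5)"
proof -
  have irr: "\<alpha> \<notin> \<rat>"
    using assms by (simp add: sturmian_word_def)
  show ?thesis
  proof (cases "\<exists>\<^sub>F n in sequentially. partial_quotient \<alpha> (Suc n) \<noteq> 1")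
    case True
    have "sqrt 5 < 8 / 3"
      by (rule real_less_lsqrt) (auto simp: power2_eq_square)
    then have "ennreal (sqrt 5) < ennreal (8 / 3)"
      by (intro ennreal_lessI) auto
    also have "\<dots> \<le> abelian_critical_exponent s"
      using abelian_critical_exponent_ge[OF irr assms] lagrange_frequently_ge_8_3[OF irr True]
      by blast
    finally show ?thesis
      by blast
  next
    case False
    then obtain N where "\<And>n. n \<ge> N \<Longrightarrow> partial_quotient \<alpha> (Suc n) = 1"
      by (auto simp: frequently_def eventually_sequentially)
    then have "partial_quotient \<alpha> n = 1" if "n \<ge> Suc N" for n
      using that by (cases n) auto
    then show ?thesis
      using abelian_critical_exponent_ge[OF irr assms] lagrange_frequently_ge_sqrt5[OF irr]
        cf_equivalent_golden_ratioI[OF irr] by blast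
  qed
qed

theorem theorem5p14:
  shows "(\<forall>\<alpha> \<rho> s. sturmian_word \<alpha> \<rho> s \<longrightarrow>
            abelian_critical_exponent s \<ge> ennreal (sqrt 5) \<and>
            (abelian_critical_exponent s = ennreal (sqrt 5) \<longleftrightarrow>
               cf_equivalent \<alpha> (golden_ratio - 1))) \<and>
         abelian_critical_exponent fibonacci_word = ennreal (sqrt 5)"
proof -
  have main: "abelian_critical_exponent s \<ge> ennreal (sqrt 5) \<and>
      (abelian_critical_exponent s = ennreal (sqrt 5) \<longleftrightarrow> cf_equivalent \<alpha> (golden_ratio - 1))"
    if "sturmian_word \<alpha> \<rho> s" for \<alpha> \<rho> s
    using abelian_critical_exponent_ge_cases[OF that] abelian_critical_exponent_le[OF that]
      cf_equivalent_golden_ratio_imp_quadratic_disc5[of \<alpha>]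
    by (metis antisym less_imp_le less_irrefl)
  have fib: "sturmian_word (golden_ratio - 1) (golden_ratio - 1) fibonacci_word"
    by (simp add: sturmian_word_fibonacci_iff)
  then have "abelian_critical_exponent fibonacci_word = ennreal (sqrt 5)"
    using main[OF fib] abelian_critical_exponent_le[OF fib] quadratic_disc5_golden_ratio
    by (intro antisym) auto
  with main show ?thesis
    by blast
qed

end
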